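(* In the setting described in the context (an analytic functional $E$ on an asymmetric Banach pair $(X,Y)$ with Fredholm Hessian $L$ and a compatible splitting, with Lyapunov--Schmidt reduced energy $\Gamma$ on $K=\ker L$), one has $$\theta_{\mathrm{LS}}(E,0)=\theta_R(\Gamma,0).$$
   Context: Setting. $X,Y$ are real Banach spaces with a continuous bilinear pairing $\langle\cdot,\cdot\rangle_{Y,X}:Y\times X\to\mathbb R$; $U\subseteq X$ is an open neighborhood of $0$; $E:U\to\mathbb R$ is real analytic with $E(0)=0$, $dE(0)=0$; $M:U\to Y$ is a real analytic map with $dE(x)[v]=\langle M(x),v\rangle_{Y,X}$ for all $x\in U$, $v\in X$. Put $L:=DM(0):X\to Y$ and assume $L$ is Fredholm. Put $K:=\ker L$ and let $Z\subset X$ be a closed complement, $X=K\oplus Z$. Assume there is a topological splitting $Y=\operatorname{Ran}L\oplus Y_K$ with $Y_K=Z^\circ:=\{y\in Y:\langle y,z\rangle_{Y,X}=0\ \forall z\in Z\}$, and that the restriction map $\rho:Y_K\to K^*$, $\rho(y)=\langle y,\cdot\rangle_{Y,X}|_K$, is an isomorphism. Lyapunov--Schmidt reduction. Let $R:Y\to\operatorname{Ran}L$ be the continuous projection along $Y_K$. By the analytic implicit function theorem there are neighborhoods $V\subset K$, $W\subset Z$ of $0$ and a unique real analytic map $\psi:V\to W$ with $\psi(0)=0$ and $RM(\xi+\psi(\xi))=0$ for $\xi\in V$. Put $c(\xi):=\xi+\psi(\xi)$; the reduced energy is the real analytic germ $\Gamma(\xi):=E(c(\xi))$. Exponents. $$\theta_{\mathrm{LS}}(E,0):=\inf\{\theta\in[1/2,1):\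 \exists C>0,\ \|M(x)\|_Y\ge C|E(x)|^\theta\text{ for all }x\text{ sufficiently close to }0\},$$ $$\theta_R(\Gamma,0):=\inf\{\theta\in[1/2,1):\ \exists C>0,\ \|D\Gamma(\xi)\|_{K^*}\ge C|\Gamma(\xi)|^\theta\text{ for all }\xi\in K\text{ sufficiently close to }0\}.$$ *)

theory Defs
  imports "HOL-Analysis.Analysis"
begin

section \<open>Real analytic maps between Banach spaces\<close>

definition linear_map_on ::
    "'a::real_vector set \<Rightarrow> ('a \<Rightarrow> 'b::real_vector) \<Rightarrow> bool" where
  "linear_map_on S f \<longleftrightarrow>
     (\<forall>x\<in>S. \<forall>y\<in>S. f (x + y) = f x + f y) \<and> (\<forall>c. \<forall>x\<in>S. f (c *\<^sub>R x) = c *\<^sub>R f x)"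

text \<open>A \<open>k\<close>-tuple of vectors of \<open>S\<close> is an element of \<open>{..<k} \<rightarrow>\<^sub>E S\<close>;
  \<open>c\<close> bounds the operator norm of the \<open>k\<close>-linear map \<open>A\<close>.\<close>

definition bounded_multilinear_on ::
    "'a::real_normed_vector set \<Rightarrow> nat \<Rightarrow> ((nat \<Rightarrow> 'a) \<Rightarrow> 'b::real_normed_vector) \<Rightarrow> real \<Rightarrow> bool" where
  "bounded_multilinear_on S k A c \<longleftrightarrow>
     (\<forall>v \<in> {..<k} \<rightarrow>\<^sub>E S. \<forall>i<k. linear_map_on S (\<lambda>x. A (v(i := x)))) \<and>
     0 \<le> c \<and> (\<forall>v \<in> {..<k} \<rightarrow>\<^sub>E S. norm (A v) \<le> c * (\<Prod>i<k. norm (v i)))"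

text \<open>Here \<open>S\<close> is a linear subspace, \<open>V\<close> is open in \<open>S\<close>, and \<open>f\<close> is regarded as a map
  on \<open>V\<close>. Since \<open>V\<close> is open in \<open>S\<close> and the radius \<open>r\<close> may be shrunk, the values of \<open>f\<close>
  outside \<open>V\<close> are irrelevant.\<close>

definition real_analytic_on ::
    "'a::real_normed_vector set \<Rightarrow> 'a set \<Rightarrow> ('a \<Rightarrow> 'b::real_normed_vector) \<Rightarrow> bool" where
  "real_analytic_on S V f \<longleftrightarrow>
     openin (top_of_set S) V \<and>
     (\<forall>a\<in>V. \<exists>r>0. \<exists>A c.
        (\<forall>k. bounded_multilinear_on S k (A k) (c k)) \<and>
        summable (\<lambda>k. c k * r ^ k) \<and>
        (\<forall>h\<in>S. norm h < r \<longrightarrow> (\<lambda>k. A k (\<lambda>i\<in>{..<k}. h)) sums f (a + h)))"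


section \<open>Fredholm operators, splittings, duals\<close>

definition fredholm :: "('a::real_normed_vector \<Rightarrow> 'b::real_normed_vector) \<Rightarrow> bool" where
  "fredholm L \<longleftrightarrow>
     bounded_linear L \<and>
     (\<exists>B. finite B \<and> span B = {x. L x = 0}) \<and>
     closed (range L) \<and>
     (\<exists>B. finite B \<and> span (range L \<union> B) = UNIV)"

definition direct_sum :: "'a::real_vector set \<Rightarrow> 'a set \<Rightarrow> bool" where
  "direct_sum S T \<longleftrightarrow>
     subspace S \<and> subspace T \<and> S \<inter> T = {0} \<and> (\<forall>x. \<exists>s\<in>S. \<exists>t\<in>T. x = s + t)"

definition proj_along :: "'a::real_vector set \<Rightarrow> 'a set \<Rightarrow> 'a \<Rightarrow> 'a" where
  "proj_along S T x = (THE s. s \<in> S \<and> x - s \<in> T)"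

definition topological_direct_sum :: "'a::real_normed_vector set \<Rightarrow> 'a set \<Rightarrow> bool" where
  "topological_direct_sum S T \<longleftrightarrow> direct_sum S T \<and> bounded_linear (proj_along S T)"

definition annihilator :: "('b \<Rightarrow> 'a \<Rightarrow> real) \<Rightarrow> 'a set \<Rightarrow> 'b set" where
  "annihilator B Z = {y. \<forall>z\<in>Z. B y z = 0}"

text \<open>The continuous dual of a subspace \<open>K\<close>; functionals are made unique as HOL functions by
  being \<open>undefined\<close> off \<open>K\<close>.\<close>

definition dual_space :: "'a::real_normed_vector set \<Rightarrow> ('a \<Rightarrow> real) set" where
  "dual_space K =
     {\<phi> \<in> extensional K. linear_map_on K \<phi> \<and> (\<exists>C. \<forall>k\<in>K. \<bar>\<phi> k\<bar> \<le> C * norm k)}"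

definition dual_norm :: "'a::real_normed_vector set \<Rightarrow> ('a \<Rightarrow> real) \<Rightarrow> real" where
  "dual_norm K \<phi> = (SUP k\<in>{k\<in>K. norm k \<le> 1}. \<bar>\<phi> k\<bar>)"

text \<open>The restriction map \<open>\<rho> y = B y \<bar> K\<close> is an isomorphism of normed spaces from \<open>T\<close>
  onto the dual of \<open>K\<close>. Linearity of \<open>\<rho>\<close> holds automatically for bilinear \<open>B\<close>.\<close>

definition restriction_isomorphism ::
    "('b::real_normed_vector \<Rightarrow> 'a::real_normed_vector \<Rightarrow> real) \<Rightarrow> 'b set \<Rightarrow> 'a set \<Rightarrow> bool" where
  "restriction_isomorphism B T K \<longleftrightarrow>
     (let \<rho> = (\<lambda>y. restrict (B y) K) in
        bij_betw \<rho> T (dual_space K) \<and>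
        (\<exists>C. \<forall>y\<in>T. dual_norm K (\<rho> y) \<le> C * norm y) \<and>
        (\<exists>C. \<forall>y\<in>T. norm y \<le> C * dual_norm K (\<rho> y)))"


section \<open>Lojasiewicz exponents\<close>

text \<open>\<open>f\<close> is a function near \<open>a\<close> in \<open>S\<close>, and \<open>g\<close> is the size of its gradient. The infimum
  is taken in the extended reals, so that it is \<open>\<infinity>\<close> if no exponent is admissible. For
  \<open>\<theta> > 0\<close> one has \<open>0 powr \<theta> = 0\<close>.\<close>

definition lojasiewicz_exponent ::
    "'a::topological_space set \<Rightarrow> ('a \<Rightarrow> real) \<Rightarrow> ('a \<Rightarrow> real) \<Rightarrow> 'a \<Rightarrow> ereal" where
  "lojasiewicz_exponent S f g a =
     (INF \<theta>\<in>{\<theta>::real. 1/2 \<le> \<theta> \<and> \<theta> < 1 \<and>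
              (\<exists>C>0. \<forall>\<^sub>F x in nhds a. x \<in> S \<longrightarrow> g x \<ge> C * \<bar>f x\<bar> powr \<theta>)}. ereal \<theta>)"

definition theta_LS ::
    "('a::real_normed_vector \<Rightarrow> 'b::real_normed_vector) \<Rightarrow> ('a \<Rightarrow> real) \<Rightarrow> 'a \<Rightarrow> ereal" where
  "theta_LS M E a = lojasiewicz_exponent UNIV E (\<lambda>x. norm (M x)) a"

text \<open>\<open>frechet_derivative \<Gamma> (at \<xi> within K)\<close> is a functional on the whole space that is
  determined only on the subspace \<open>K\<close>; \<open>dual_norm K\<close> sees exactly its restriction to \<open>K\<close>.\<close>

definition theta_R ::
    "'a::real_normed_vector set \<Rightarrow> ('a \<Rightarrow> real) \<Rightarrow> 'a \<Rightarrow> ereal" where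
  "theta_R K \<Gamma> a =
     lojasiewicz_exponent K \<Gamma> (\<lambda>\<xi>. dual_norm K (frechet_derivative \<Gamma> (at \<xi> within K))) a"

end

theory Submission
  imports Defs
begin

text \<open>
  For a fixed exponent \<open>\<theta> \<in> [1/2, 1)\<close>, the gradient inequality for \<open>E\<close> at \<open>0\<close> is equivalent
  to the one for \<open>\<Gamma>\<close>; hence the two infima run over the same set. Both implications come from
  comparing the two problems along a map: \<open>c\<close> takes points of \<open>K\<close> to points of the whole space,
  and the projection \<open>p\<close> onto \<open>K\<close> along \<open>Z\<close> goes back to \<open>K\<close>. The comparison lemma
  \<open>lojasiewicz_exponent_le\<close> asks of such a map that the gradient at the image be at most a
  constant times the gradient at the point, and that the size of the value at the point exceed
  that at the image by at most a constant times the \<^emph>\<open>square\<close> of the gradient. A quadratic error does no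
  harm: its power \<open>\<theta>\<close> is of order \<open>2\<theta> \<ge> 1\<close> in the small gradient.

  \<^emph>\<open>The map \<open>c\<close>.\<close> The reduced equation says \<open>M (c \<xi>) \<in> Y\<^sub>K\<close>, that is, \<open>M (c \<xi>)\<close> annihilates
  \<open>Z\<close>. As \<open>\<psi>\<close> takes values in \<open>Z\<close>, the chain rule gives
  \<open>\<Gamma>(\<xi> + h) - \<Gamma>(\<xi>) = \<langle>M (c \<xi>), h\<rangle> + o(h)\<close>, so \<open>D\<Gamma>(\<xi>)\<close> is the restriction \<open>\<rho> (M (c \<xi>))\<close>. As
  \<open>\<rho>\<close> is an isomorphism, \<open>\<parallel>D\<Gamma>(\<xi>)\<parallel>\<close> and \<open>\<parallel>M (c \<xi>)\<parallel>\<close> are comparable, and \<open>\<Gamma>(\<xi>) = E (c \<xi>)\<close>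
  exactly.

  \<^emph>\<open>The map \<open>p\<close>.\<close> Let \<open>x\<close> be small and let \<open>w = x - c (p x)\<close>, a vector of \<open>Z\<close>. On \<open>Z\<close> the
  operator \<open>L\<close> is bounded below (\<open>bounded_inverse_on_closed_subspace\<close>), and \<open>M\<close> differs from
  \<open>L\<close> by a map with a small Lipschitz constant near \<open>0\<close> (\<open>real_analytic_on_strict_derivative\<close>).
  Because \<open>R M\<close> vanishes at \<open>c (p x)\<close>, this yields \<open>\<parallel>w\<parallel> \<le> P \<parallel>M x\<parallel>\<close>
  (\<open>transversal_error_le\<close>). Hence \<open>\<parallel>M\<parallel>\<close> is of order \<open>\<parallel>M x\<parallel>\<close> on the whole segment from \<open>x\<close>
  to \<open>c (p x)\<close>, and integrating \<open>dE = \<langle>M, \<cdot>\<rangle>\<close> along that segment gives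
  \<open>\<bar>E x - \<Gamma> (p x)\<bar> \<le> C \<parallel>M x\<parallel>\<^sup>2\<close> (\<open>energy_gap_le\<close>).
\<close>

section \<open>Strict differentiability of analytic maps\<close>

text \<open>Replacing \<open>h'\<close> by \<open>h\<close> in one argument at a time splits the difference into \<open>k\<close> terms,
  each of which has one argument \<open>h - h'\<close> and \<open>k - 1\<close> arguments of norm at most \<open>\<rho>\<close>.\<close>

lemma multilinear_diagonal_diff_le:
  assumes S: "subspace S" and A: "bounded_multilinear_on S k A c"
    and h: "h \<in> S" "h' \<in> S" "norm h \<le> \<rho>" "norm h' \<le> \<rho>"
  shows "norm (A (\<lambda>i\<in>{..<k}. h) - A (\<lambda>i\<in>{..<k}. h')) \<le> real k * (c * \<rho> ^ (k - 1) * norm (h - h'))"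
proof -
  define v where "v j = (\<lambda>i\<in>{..<k}. if i < j then h else h')" for j
  have \<rho>: "0 \<le> \<rho>" using h(3) norm_ge_zero order_trans by blast
  have c0: "0 \<le> c" using A by (simp add: bounded_multilinear_on_def)
  have d: "h - h' \<in> S" using S h by (simp add: subspace_diff)
  have step: "norm (A (v (Suc j)) - A (v j)) \<le> c * \<rho> ^ (k - 1) * norm (h - h')" if j: "j < k" for j
  proof -
    let ?w = "(v j)(j := h - h')"
    have v: "v j \<in> {..<k} \<rightarrow>\<^sub>E S" using h by (auto simp: v_def)
    have w: "?w \<in> {..<k} \<rightarrow>\<^sub>E S" using v d j by (auto simp: PiE_iff extensional_def)
    have e1: "v (Suc j) = (v j)(j := h)" using j by (auto simp: v_def fun_eq_iff)
    have e2: "v j = (v j)(j := h')" using j by (auto simp: v_def fun_eq_iff)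
    have lin: "linear_map_on S (\<lambda>x. A ((v j)(j := x)))"
      using A v j unfolding bounded_multilinear_on_def by blast
    have "A ((v j)(j := (h - h') + h')) = A ?w + A ((v j)(j := h'))"
      using lin d h(2) unfolding linear_map_on_def by blast
    then have diff: "A (v (Suc j)) - A (v j) = A ?w" using e1 e2 by simp
    have "(\<Prod>i<k. norm (?w i)) = norm (h - h') * (\<Prod>i\<in>{..<k}-{j}. norm (?w i))"
      using j by (subst prod.remove[of _ j]) auto
    also have "\<dots> \<le> norm (h - h') * (\<Prod>i\<in>{..<k}-{j}. \<rho>)"
      using h by (intro mult_left_mono prod_mono) (auto simp: v_def)
    also have "(\<Prod>i\<in>{..<k}-{j}. \<rho>) = \<rho> ^ (k - 1)" using j by simp
    finally have prod_le: "(\<Prod>i<k. norm (?w i)) \<le> norm (h - h') * \<rho> ^ (k - 1)" .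
    have "norm (A ?w) \<le> c * (\<Prod>i<k. norm (?w i))"
      using A w unfolding bounded_multilinear_on_def by blast
    also have "\<dots> \<le> c * (norm (h - h') * \<rho> ^ (k - 1))"
      using prod_le c0 by (rule mult_left_mono)
    finally show ?thesis by (simp only: diff mult_ac)
  qed
  have "A (\<lambda>i\<in>{..<k}. h) - A (\<lambda>i\<in>{..<k}. h') = A (v k) - A (v 0)"
    by (simp add: v_def restrict_def cong: if_cong)
  also have "\<dots> = (\<Sum>j<k. A (v (Suc j)) - A (v j))"
    by (rule sum_lessThan_telescope[symmetric])
  also have "norm \<dots> \<le> (\<Sum>j<k. c * \<rho> ^ (k - 1) * norm (h - h'))"
    by (rule sum_norm_le) (use step in simp)
  finally show ?thesis by simp
qed

text \<open>The constant terms of the two power series cancel and the linear ones combine to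
  \<open>A1 (h - h')\<close>. What remains starts in degree two, which is where the factor \<open>\<rho>\<close> comes from.
  The map \<open>A1\<close> lives on the subspace only; it need not be the restriction of a bounded operator
  on the ambient space, so the estimate is phrased without \<open>has_derivative\<close>.\<close>

lemma real_analytic_on_strictly_differentiable:
  fixes f :: "'a::real_normed_vector \<Rightarrow> 'b::banach"
  assumes S: "subspace S" and f: "real_analytic_on S V f" and a: "a \<in> V"
  obtains A1 b D r where "linear_map_on S A1" "\<And>h. h \<in> S \<Longrightarrow> norm (A1 h) \<le> b * norm h"
    "0 \<le> b" "0 \<le> D" "0 < r"
    "\<And>\<rho> h h'. \<lbrakk>h \<in> S; h' \<in> S; norm h \<le> \<rho>; norm h' \<le> \<rho>; \<rho> \<le> r\<rbrakk>
       \<Longrightarrow> norm (f (a + h) - f (a + h') - A1 (h - h')) \<le> D * \<rho> * norm (h - h')"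
proof -
  obtain r A c where r: "r > 0" and A: "\<And>k. bounded_multilinear_on S k (A k) (c k)"
    and sm: "summable (\<lambda>k. c k * r ^ k)"
    and ser: "\<And>h. h \<in> S \<Longrightarrow> norm h < r \<Longrightarrow> (\<lambda>k. A k (\<lambda>i\<in>{..<k}. h)) sums f (a + h)"
    using bspec[OF conjunct2[OF f[unfolded real_analytic_on_def]] a] by blast
  have c0: "0 \<le> c k" for k using A by (simp add: bounded_multilinear_on_def)
  define A1 where "A1 h = A 1 (\<lambda>i\<in>{..<1}. h)" for h
  have upd: "(\<lambda>i\<in>{..<1}. 0)(0 := x) = (\<lambda>i\<in>{..<1::nat}. x)" for x :: 'a
    by (auto simp: fun_eq_iff)
  have "(\<lambda>i\<in>{..<1::nat}. 0) \<in> {..<1} \<rightarrow>\<^sub>E S" using S by (auto simp: subspace_0)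
  then have "linear_map_on S (\<lambda>x. A 1 ((\<lambda>i\<in>{..<1}. 0)(0 := x)))"
    using A[of 1] unfolding bounded_multilinear_on_def by auto
  then have lin: "linear_map_on S A1" by (simp only: upd A1_def[abs_def])
  have bd: "norm (A1 h) \<le> c 1 * norm h" if "h \<in> S" for h
  proof -
    have "(\<lambda>i\<in>{..<1::nat}. h) \<in> {..<1} \<rightarrow>\<^sub>E S" using that by auto
    then have "norm (A1 h) \<le> c 1 * (\<Prod>i<1. norm ((\<lambda>i\<in>{..<1::nat}. h) i))"
      using A[of 1] unfolding bounded_multilinear_on_def A1_def by blast
    then show ?thesis by simp
  qed
  define D where "D = 4 / r\<^sup>2 * (\<Sum>k. c k * r ^ k)"
  have D0: "0 \<le> D" unfolding D_def using r c0 sm by (intro mult_nonneg_nonneg suminf_nonneg) auto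
  have est: "norm (f (a + h) - f (a + h') - A1 (h - h')) \<le> D * \<rho> * norm (h - h')"
    if h: "h \<in> S" "h' \<in> S" "norm h \<le> \<rho>" "norm h' \<le> \<rho>" and \<rho>: "\<rho> \<le> r / 2" for \<rho> h h'
  proof -
    have \<rho>0: "0 \<le> \<rho>" using h(3) norm_ge_zero order_trans by blast
    let ?T = "\<lambda>h k. A k (\<lambda>i\<in>{..<k}. h)"
    let ?d = "\<lambda>k. ?T h k - ?T h' k - (if k = 1 then A1 (h - h') else 0)"
    have dS: "h - h' \<in> S" using S h by (simp add: subspace_diff)
    have "(\<lambda>k. ?T h k - ?T h' k) sums (f (a + h) - f (a + h'))"
      using h \<rho> r by (intro sums_diff ser) auto
    moreover have "(\<lambda>k. if k = 1 then A1 (h - h') else 0) sums A1 (h - h')"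
      using sums_single[of 1 "\<lambda>_. A1 (h - h')"] by simp
    ultimately have s1: "?d sums (f (a + h) - f (a + h') - A1 (h - h'))" by (rule sums_diff)
    have s2: "(\<lambda>k. (4 / r\<^sup>2 * \<rho> * norm (h - h')) * (c k * r ^ k)) sums (D * \<rho> * norm (h - h'))"
      using sums_mult[OF summable_sums[OF sm], of "4 / r\<^sup>2 * \<rho> * norm (h - h')"]
      by (simp add: D_def mult_ac)
    have le: "norm (?d k) \<le> (4 / r\<^sup>2 * \<rho> * norm (h - h')) * (c k * r ^ k)" for k
    proof (cases "k < 2")
      case True
      have "?d k = 0"
      proof (cases "k = 0")
        case True then show ?thesis by (simp add: restrict_def)
      next
        case False
        with True have k: "k = 1" by simp
        have "A1 ((h - h') + h') = A1 (h - h') + A1 h'"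
          using lin dS h(2) unfolding linear_map_on_def by blast
        then show ?thesis by (simp add: k A1_def)
      qed
      then show ?thesis using c0 r \<rho>0 by simp
    next
      case False
      then obtain n where k: "k = n + 2" using le_Suc_ex[of 2 k] by auto
      have "\<rho> ^ n \<le> (r / 2) ^ n" using \<rho>0 \<rho> by (rule power_mono[rotated])
      \<comment> \<open>the factor \<open>k\<close> from differentiating \<open>h\<^sup>k\<close> is absorbed by halving the radius\<close>
      moreover have "real k \<le> 2 ^ k" by (simp add: less_imp_le of_nat_less_two_power)
      ultimately have "real k * \<rho> ^ n \<le> 2 ^ k * (r / 2) ^ n"
        using \<rho>0 by (intro mult_mono) auto
      also have "\<dots> = 4 / r\<^sup>2 * r ^ k" using r by (simp add: k power_add power_divide power2_eq_square)
      finally have q: "real k * \<rho> ^ n \<le> 4 / r\<^sup>2 * r ^ k" .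
      have "norm (?d k) \<le> real k * (c k * \<rho> ^ (k - 1) * norm (h - h'))"
        using multilinear_diagonal_diff_le[OF S A[of k] h] k by simp
      also have "\<dots> = (c k * \<rho> * norm (h - h')) * (real k * \<rho> ^ n)" by (simp add: k)
      also have "\<dots> \<le> (c k * \<rho> * norm (h - h')) * (4 / r\<^sup>2 * r ^ k)"
        using c0 \<rho>0 by (intro mult_left_mono q) auto
      finally show ?thesis by (simp add: mult_ac)
    qed
    show ?thesis by (rule norm_sums_le[OF s1 s2 le])
  qed
  show thesis
    by (rule that[where r = "r / 2", OF lin bd c0 D0 _ est]) (use r in auto)
qed

text \<open>On the whole space the linear term of the power series is the Frechet derivative.\<close>

lemma real_analytic_on_strict_derivative:
  fixes f :: "'a::real_normed_vector \<Rightarrow> 'b::banach"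
  assumes f: "real_analytic_on UNIV V f" "a \<in> V" and L: "(f has_derivative L) (at a)"
  obtains D r where "0 \<le> D" "0 < r"
    "\<And>\<rho> x y. \<lbrakk>norm (x - a) \<le> \<rho>; norm (y - a) \<le> \<rho>; \<rho> \<le> r\<rbrakk>
       \<Longrightarrow> norm (f x - f y - L (x - y)) \<le> D * \<rho> * norm (x - y)"
proof -
  obtain A1 b D r where lin: "linear_map_on UNIV A1"
    and b: "\<And>h. h \<in> UNIV \<Longrightarrow> norm (A1 h) \<le> b * norm h"
    and D: "0 \<le> D" and r: "0 < r"
    and est: "\<And>\<rho> h h'. \<lbrakk>h \<in> UNIV; h' \<in> UNIV; norm h \<le> \<rho>; norm h' \<le> \<rho>; \<rho> \<le> r\<rbrakk>
       \<Longrightarrow> norm (f (a + h) - f (a + h') - A1 (h - h')) \<le> D * \<rho> * norm (h - h')"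
    by (rule real_analytic_on_strictly_differentiable[OF subspace_UNIV f]) blast
  have bl: "bounded_linear A1"
    by (rule bounded_linear_intro[where K = b])
      (use lin b in \<open>auto simp: linear_map_on_def mult.commute\<close>)
  have A10: "A1 0 = 0" using bl by (rule linear_simps(3))
  have "(f has_derivative A1) (at a)"
    unfolding has_derivative_at_alt
  proof (intro conjI bl allI impI)
    fix e :: real assume e: "0 < e"
    show "\<exists>d>0. \<forall>y. norm (y - a) < d \<longrightarrow> norm (f y - f a - A1 (y - a)) \<le> e * norm (y - a)"
    proof (intro exI[of _ "min r (e / (D + 1))"] conjI allI impI)
      show "0 < min r (e / (D + 1))" using r e D by simp
      fix y assume y: "norm (y - a) < min r (e / (D + 1))"
      then have "(D + 1) * norm (y - a) \<le> e" using D by (simp add: field_simps)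
      then have "D * norm (y - a) \<le> e" using norm_ge_zero[of "y - a"] by (simp only: distrib_right)
      then have "D * norm (y - a) * norm (y - a) \<le> e * norm (y - a)" by (rule mult_right_mono) simp
      moreover have "norm (f y - f a - A1 (y - a)) \<le> D * norm (y - a) * norm (y - a)"
        using est[of "y - a" 0 "norm (y - a)"] y by simp
      ultimately show "norm (f y - f a - A1 (y - a)) \<le> e * norm (y - a)" by simp
    qed
  qed
  then have "A1 = L" using L by (rule has_derivative_unique)
  show thesis
  proof (rule that[OF D r])
    fix \<rho> x y assume "norm (x - a) \<le> \<rho>" "norm (y - a) \<le> \<rho>" "\<rho> \<le> r"
    then show "norm (f x - f y - L (x - y)) \<le> D * \<rho> * norm (x - y)"
      using est[of "x - a" "y - a" \<rho>] \<open>A1 = L\<close> by simp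
  qed
qed

lemma real_analytic_on_calm:
  fixes f :: "'a::real_normed_vector \<Rightarrow> 'b::banach"
  assumes S: "subspace S" and f: "real_analytic_on S V f" and a: "a \<in> V"
  obtains P where "0 \<le> P" "\<forall>\<^sub>F x in at a within S. norm (f x - f a) \<le> P * norm (x - a)"
proof -
  have aS: "a \<in> S"
    using f a openin_imp_subset unfolding real_analytic_on_def by blast
  obtain A1 b D r where b: "\<And>h. h \<in> S \<Longrightarrow> norm (A1 h) \<le> b * norm h" "0 \<le> b"
    and D: "0 \<le> D" and r: "0 < r"
    and est: "\<And>\<rho> h h'. \<lbrakk>h \<in> S; h' \<in> S; norm h \<le> \<rho>; norm h' \<le> \<rho>; \<rho> \<le> r\<rbrakk>
       \<Longrightarrow> norm (f (a + h) - f (a + h') - A1 (h - h')) \<le> D * \<rho> * norm (h - h')"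
    by (rule real_analytic_on_strictly_differentiable[OF S f a]) blast
  show thesis
  proof (rule that[of "b + D * r"])
    show "0 \<le> b + D * r" using b D r by simp
    have "norm (f x - f a) \<le> (b + D * r) * norm (x - a)" if "x \<in> S" "dist x a < r" for x
    proof -
      have xa: "x - a \<in> S" using S that aS by (simp add: subspace_diff)
      have "norm (f x - f a - A1 (x - a)) \<le> D * r * norm (x - a)"
        using est[of "x - a" 0 r] that S xa r by (simp add: dist_norm subspace_0)
      moreover have "norm (f x - f a) \<le> norm (A1 (x - a)) + norm (f x - f a - A1 (x - a))"
        using norm_triangle_sub by blast
      ultimately show ?thesis using b(1)[OF xa] by (simp add: distrib_right)
    qed
    then show "\<forall>\<^sub>F x in at a within S. norm (f x - f a) \<le> (b + D * r) * norm (x - a)"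
      using r by (auto simp: eventually_at)
  qed
qed

section \<open>Bounded inverses\<close>

text \<open>The bounded inverse theorem, by Banach's argument. The closed subspace \<open>L ` S\<close> is a Baire
  space covered by the closures of the images of the balls of integer radius, so one of these
  closures has an interior point. Subtracting approximate preimages of this point and of points
  nearby, and rescaling, one solves \<open>L x = y\<close> up to an error \<open>\<parallel>y\<parallel> / 2\<close> with \<open>\<parallel>x\<parallel> \<le> C \<parallel>y\<parallel>\<close>.
  Iterating on the error gives an exact solution of norm at most \<open>2 C \<parallel>y\<parallel>\<close>, which is the given
  one by injectivity.\<close>

lemma bounded_inverse_on_closed_subspace:
  fixes L :: "'a::banach \<Rightarrow> 'b::banach"
  assumes L: "bounded_linear L" and S: "subspace S" "closed S"
    and T: "closed (L ` S)" and inj: "inj_on L S"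
  obtains m where "0 < m" "\<And>x. x \<in> S \<Longrightarrow> norm x \<le> m * norm (L x)"
proof -
  interpret L: bounded_linear L by fact
  define T where "T = L ` S"
  have clT: "closed T" using T by (simp add: T_def)
  have subT: "subspace T" unfolding T_def using L.linear S(1) by (rule linear_subspace_image)
  define F where "F n = closure (L ` (S \<inter> cball 0 (real n)))" for n :: nat
  have FT: "F n \<subseteq> T" for n
    unfolding F_def using clT by (intro closure_minimal) (auto simp: T_def)
  have "y \<in> (\<Union>n. F n)" if y: "y \<in> T" for y
  proof -
    obtain x where x: "x \<in> S" "y = L x" using y by (auto simp: T_def)
    obtain n :: nat where "norm x \<le> real n" using real_arch_simple by blast
    then have "y \<in> F n" unfolding F_def using x by (intro closure_subset[THEN subsetD]) auto
    then show ?thesis by blast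
  qed
  then have UF: "\<Union>(range F) = T" using FT by blast
  have "\<exists>n. top_of_set T interior_of F n \<noteq> {}"
  proof (rule ccontr)
    assume "\<not> ?thesis"
    then have "top_of_set T interior_of \<Union>(range F) = {}"
      using clT FT
      by (intro Baire_category_alt disjI1 completely_metrizable_space_closedin
          completely_metrizable_space_euclidean)
        (auto simp: F_def intro!: closed_subset)
    moreover have "top_of_set T interior_of T = T"
      using interior_of_topspace[of "top_of_set T"] by simp
    ultimately show False using UF subT subspace_0 by force
  qed
  then obtain n y0 where "y0 \<in> top_of_set T interior_of F n" by blast
  then obtain G where "openin (top_of_set T) G" "y0 \<in> G" "G \<subseteq> F n"
    by (auto simp: interior_of_def)
  then obtain r where y0: "y0 \<in> T" and r: "r > 0" and rF: "ball y0 r \<inter> T \<subseteq> F n"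
    unfolding openin_contains_ball by (meson subset_iff)
  have appr: "\<exists>x\<in>S. norm x \<le> (4 * real n / r) * norm y \<and> norm (y - L x) \<le> norm y / 2"
    if y: "y \<in> T" for y
  proof (cases "y = 0")
    case True
    then show ?thesis using S by (intro bexI[of _ 0]) (auto simp: subspace_0 L.zero)
  next
    case False
    define t where "t = r / (2 * norm y)"
    have t: "t > 0" using r False by (simp add: t_def)
    have close: "\<exists>u\<in>S. norm u \<le> real n \<and> norm (p - L u) < r / 8" if p: "p \<in> F n" for p
    proof -
      obtain q where "q \<in> L ` (S \<inter> cball 0 (real n))" "dist q p < r / 8"
        using p r unfolding F_def closure_approachable by (elim allE[of _ "r / 8"]) auto
      then show ?thesis by (auto simp: dist_norm norm_minus_commute)
    qed
    have "norm (t *\<^sub>R y) < r" using t False r by (simp add: t_def)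
    then have "y0 + t *\<^sub>R y \<in> F n"
      using rF y0 y subT by (auto simp: dist_norm subspace_add subspace_scale)
    then obtain u where u: "u \<in> S" "norm u \<le> real n" "norm (y0 + t *\<^sub>R y - L u) < r / 8"
      using close by blast
    have "y0 \<in> F n" using rF y0 r by auto
    then obtain v where v: "v \<in> S" "norm v \<le> real n" "norm (y0 - L v) < r / 8"
      using close by blast
    define x where "x = (1 / t) *\<^sub>R (u - v)"
    have xS: "x \<in> S" using S u v by (simp add: x_def subspace_scale subspace_diff)
    have "norm (u - v) \<le> 2 * real n" using u v norm_triangle_ineq4[of u v] by simp
    then have "norm x \<le> 2 * real n / t"
      using t by (simp add: x_def divide_right_mono)
    then have nx: "norm x \<le> (4 * real n / r) * norm y"
      by (simp add: t_def mult_ac)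
    have "t *\<^sub>R (y - L x) = (y0 + t *\<^sub>R y - L u) - (y0 - L v)"
      using t by (simp add: x_def L.scaleR L.diff algebra_simps)
    then have "t * norm (y - L x) = norm ((y0 + t *\<^sub>R y - L u) - (y0 - L v))"
      using t by (metis abs_of_pos norm_scaleR)
    then have "t * norm (y - L x) \<le> r / 8 + r / 8"
      using u v norm_triangle_ineq4[of "y0 + t *\<^sub>R y - L u" "y0 - L v"] by simp
    then have "norm (y - L x) \<le> r / (4 * t)"
      using t by (simp add: field_simps)
    then have "norm (y - L x) \<le> norm y / 2"
      using r by (simp add: t_def)
    with xS nx show ?thesis by blast
  qed
  define C where "C = 4 * real n / r"
  have C0: "0 \<le> C" using r by (simp add: C_def)
  obtain g where g: "\<And>y. y \<in> T \<Longrightarrow> g y \<in> S" "\<And>y. y \<in> T \<Longrightarrow> norm (g y) \<le> C * norm y"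
     "\<And>y. y \<in> T \<Longrightarrow> norm (y - L (g y)) \<le> norm y / 2"
    using appr unfolding C_def by metis
  have main: "norm x \<le> (2 * C) * norm (L x)" if x: "x \<in> S" for x
  proof -
    define res where "res k = ((\<lambda>y. y - L (g y)) ^^ k) (L x)" for k
    have res_Suc: "res (Suc k) = res k - L (g (res k))" for k by (simp add: res_def)
    have resT: "res k \<in> T" for k
    proof (induction k)
      case 0 then show ?case using x by (simp add: res_def T_def)
    next
      case (Suc k) then show ?case
        using g(1) subT by (auto simp: res_Suc T_def intro!: subspace_diff)
    qed
    have res_le: "norm (res k) \<le> norm (L x) * (1/2) ^ k" for k
    proof (induction k)
      case 0 then show ?case by (simp add: res_def)
    next
      case (Suc k)
      then show ?case using g(3)[OF resT[of k]] by (simp add: res_Suc)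
    qed
    have gle: "norm (g (res k)) \<le> (C * norm (L x)) * (1/2) ^ k" for k
      using order_trans[OF g(2)[OF resT] mult_left_mono[OF res_le C0]] by (simp add: mult_ac)
    have geo: "(\<lambda>k. (C * norm (L x)) * (1/2) ^ k) sums ((C * norm (L x)) * 2)"
      using sums_mult[OF geometric_sums[of "1/2::real"], of "C * norm (L x)"] by simp
    have sm: "summable (\<lambda>k. g (res k))"
      by (rule summable_comparison_test'[OF sums_summable[OF geo]]) (rule gle)
    define s where "s = (\<Sum>k. g (res k))"
    have s: "(\<lambda>k. g (res k)) sums s" using sm by (simp add: s_def summable_sums)
    have sS: "s \<in> S"
      using s S(2) unfolding sums_def
      by (rule closed_sequentially[rotated 2, where f="\<lambda>n. \<Sum>k<n. g (res k)"])
         (use S(1) g(1) resT in \<open>auto intro: subspace_sum\<close>)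
    have "(\<lambda>k. norm (L x) * (1/2) ^ k) \<longlonglongrightarrow> norm (L x) * 0"
      by (intro tendsto_mult tendsto_const LIMSEQ_power_zero) simp
    then have "res \<longlonglongrightarrow> 0"
      using Lim_null_comparison[OF always_eventually[OF allI[OF res_le]]] by simp
    then have "(\<lambda>k. res k - res (Suc k)) sums (res 0 - 0)" by (rule telescope_sums')
    then have "(\<lambda>k. L (g (res k))) sums L x" by (simp add: res_Suc) (simp add: res_def)
    then have "L s = L x" using L.sums[OF s] sums_unique2 by blast
    then have "s = x" using inj sS x by (auto dest: inj_onD)
    moreover have "norm s \<le> (C * norm (L x)) * 2"
      by (rule norm_sums_le[OF s geo gle])
    ultimately show ?thesis by (simp add: mult_ac)
  qed
  show thesis
  proof (rule that[of "2 * C + 1"])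
    show "0 < 2 * C + 1" using C0 by simp
    fix x assume "x \<in> S"
    then have "norm x \<le> (2 * C) * norm (L x)" by (rule main)
    then show "norm x \<le> (2 * C + 1) * norm (L x)"
      using norm_ge_zero[of "L x"] unfolding distrib_right by linarith
  qed
qed

section \<open>Projections along a direct summand\<close>

lemma proj_along_eq:
  assumes ST: "direct_sum S T" and s: "s \<in> S" "x - s \<in> T"
  shows "proj_along S T x = s"
  unfolding proj_along_def
proof (rule the_equality)
  fix s' assume s': "s' \<in> S \<and> x - s' \<in> T"
  have "s' - s \<in> S" "s' - s \<in> T"
    using ST s s' subspace_diff[of S s' s] subspace_diff[of T "x - s" "x - s'"]
    by (auto simp: direct_sum_def)
  then have "s' - s = 0" using ST unfolding direct_sum_def by blast
  then show "s' = s" by simp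
qed (use s in blast)

lemma direct_sum_decomposition:
  assumes ST: "direct_sum S T"
  shows "proj_along S T x \<in> S" "x - proj_along S T x \<in> T"
proof -
  obtain s t where st: "s \<in> S" "t \<in> T" "x = s + t" using ST unfolding direct_sum_def by blast
  then have "proj_along S T x = s" using ST by (intro proj_along_eq) auto
  then show "proj_along S T x \<in> S" "x - proj_along S T x \<in> T" using st by auto
qed

section \<open>Derivatives within a subspace and dual norms\<close>

text \<open>The lines through \<open>a\<close> in directions of \<open>S\<close> stay inside \<open>S\<close> and determine the derivative
  there. This identifies the arbitrary choice made by \<open>frechet_derivative\<close>.\<close>

lemma has_derivative_within_subspace_unique:
  assumes f: "(f has_derivative F) (at a within S)" "(f has_derivative G) (at a within S)"
    and S: "subspace S" "a \<in> S" "k \<in> S"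
  shows "F k = G k"
proof -
  have line: "((\<lambda>t. f (a + t *\<^sub>R k)) has_derivative (\<lambda>t. H (t *\<^sub>R k))) (at (0::real))"
    if "(f has_derivative H) (at a within S)" for H
  proof -
    have g: "((\<lambda>t. a + t *\<^sub>R k) has_derivative (\<lambda>t. t *\<^sub>R k)) (at (0::real))"
      by (auto intro!: derivative_eq_intros)
    have "(\<lambda>t. a + t *\<^sub>R k) ` UNIV \<subseteq> S"
      using S by (auto intro: subspace_add subspace_scale)
    with that have "(f has_derivative H) (at a within (\<lambda>t. a + t *\<^sub>R k) ` UNIV)"
      by (rule has_derivative_subset)
    then have "(f has_derivative H) (at (a + 0 *\<^sub>R k) within (\<lambda>t. a + t *\<^sub>R k) ` UNIV)"
      by simp
    from has_derivative_in_compose[OF g this] show ?thesis by simp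
  qed
  have "(\<lambda>t. F (t *\<^sub>R k)) = (\<lambda>t. G (t *\<^sub>R k))"
    using line[OF f(1)] line[OF f(2)] by (rule has_derivative_unique)
  from fun_cong[OF this, of 1] show ?thesis by simp
qed

text \<open>A chain rule in which the inner map need not be differentiable: a linear growth bound suffices
  as soon as the outer derivative turns the increments of the inner map into a linear function.
  It is applied to a graph \<open>c \<xi> = \<xi> + \<psi> \<xi>\<close> with the increments of \<open>\<psi>\<close> in the kernel of \<open>F\<close>.\<close>

lemma has_derivative_compose_calm:
  fixes E :: "'a::real_normed_vector \<Rightarrow> 'b::real_normed_vector"
    and c :: "'c::real_normed_vector \<Rightarrow> 'a"
  assumes E: "(E has_derivative F) (at (c x))"
    and calm: "\<forall>\<^sub>F y in at x within S. norm (c y - c x) \<le> P * norm (y - x)"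
    and G: "bounded_linear G" "\<forall>\<^sub>F y in at x within S. F (c y - c x) = G (y - x)"
  shows "((\<lambda>y. E (c y)) has_derivative G) (at x within S)"
  unfolding has_derivative_within_alt2
proof (intro conjI allI impI G(1))
  fix e :: real assume e: "e > 0"
  define e' where "e' = e / (\<bar>P\<bar> + 1)"
  have e': "e' > 0" using e by (simp add: e'_def)
  have "\<forall>\<^sub>F p in at (c x). norm (E p - E (c x) - F (p - c x)) \<le> e' * norm (p - c x)"
    using E e' unfolding has_derivative_within_alt2 by blast
  moreover have "F 0 = 0" using E linear_0 has_derivative_linear by blast
  ultimately have near: "\<forall>\<^sub>F p in nhds (c x). norm (E p - E (c x) - F (p - c x)) \<le> e' * norm (p - c x)"
    by (auto simp: eventually_nhds_conv_at)
  have "((\<lambda>y. P * norm (y - x)) \<longlongrightarrow> P * norm (x - x)) (at x within S)"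
    by (intro tendsto_intros)
  then have "((\<lambda>y. c y - c x) \<longlongrightarrow> 0) (at x within S)"
    using Lim_null_comparison[OF calm] by simp
  then have "(c \<longlongrightarrow> c x) (at x within S)" by (simp add: LIM_zero_iff)
  from calm G(2) eventually_compose_filterlim[OF near this]
  show "\<forall>\<^sub>F y in at x within S. norm (E (c y) - E (c x) - G (y - x)) \<le> e * norm (y - x)"
  proof eventually_elim
    case (elim y)
    have "e' * norm (c y - c x) \<le> e' * (P * norm (y - x))"
      using elim(1) e' by (intro mult_left_mono) auto
    also have "\<dots> \<le> e' * ((\<bar>P\<bar> + 1) * norm (y - x))"
      using e' by (intro mult_left_mono mult_right_mono) auto
    also have "\<dots> = e * norm (y - x)"
      by (simp add: e'_def add_nonneg_eq_0_iff)
    finally show ?case using elim by simp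
  qed
qed

lemma dual_norm_cong: "(\<And>k. k \<in> K \<Longrightarrow> \<phi> k = \<phi>' k) \<Longrightarrow> dual_norm K \<phi> = dual_norm K \<phi>'"
  unfolding dual_norm_def by (rule SUP_cong) auto

lemma dual_norm_frechet_derivative:
  assumes f: "(f has_derivative F) (at a within K)" and K: "subspace K" "a \<in> K"
  shows "dual_norm K (frechet_derivative f (at a within K)) = dual_norm K F"
proof (rule dual_norm_cong)
  have "(f has_derivative frechet_derivative f (at a within K)) (at a within K)"
    using f by (simp add: frechet_derivative_works[symmetric] differentiableI)
  then show "frechet_derivative f (at a within K) k = F k" if "k \<in> K" for k
    using f K that by (rule has_derivative_within_subspace_unique)
qed

text \<open>Membership in the dual space guarantees that the supremum is taken over a bounded set.\<close>

lemma dual_norm_nonneg: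
  assumes "\<phi> \<in> dual_space K" "0 \<in> K"
  shows "0 \<le> dual_norm K \<phi>"
proof -
  obtain C where C: "\<And>k. k \<in> K \<Longrightarrow> \<bar>\<phi> k\<bar> \<le> C * norm k"
    using assms unfolding dual_space_def by blast
  have "\<bar>\<phi> k\<bar> \<le> \<bar>C\<bar>" if "k \<in> K" "norm k \<le> 1" for k
  proof -
    have "C * norm k \<le> \<bar>C\<bar> * 1" using that by (intro mult_mono) auto
    then show ?thesis using C[OF that(1)] by simp
  qed
  then have "bdd_above ((\<lambda>k. \<bar>\<phi> k\<bar>) ` {k \<in> K. norm k \<le> 1})"
    by (intro bdd_aboveI2[where M = "\<bar>C\<bar>"]) auto
  then show ?thesis unfolding dual_norm_def using assms(2) by (intro cSUP_upper2[of _ _ 0]) auto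
qed

lemma restriction_isomorphismD:
  assumes iso: "restriction_isomorphism B T K" and K: "0 \<in> K"
  obtains C where "0 < C" "\<And>y. y \<in> T \<Longrightarrow> dual_norm K (B y) \<le> C * norm y"
    "\<And>y. y \<in> T \<Longrightarrow> norm y \<le> C * dual_norm K (B y)"
    "\<And>y y'. \<lbrakk>y \<in> T; y' \<in> T; \<And>k. k \<in> K \<Longrightarrow> B y k = B y' k\<rbrakk> \<Longrightarrow> y = y'"
proof -
  have res: "dual_norm K (restrict (B y) K) = dual_norm K (B y)" for y
    by (rule dual_norm_cong) simp
  obtain C1 C2 where bij: "bij_betw (\<lambda>y. restrict (B y) K) T (dual_space K)"
    and C1: "\<And>y. y \<in> T \<Longrightarrow> dual_norm K (B y) \<le> C1 * norm y"
    and C2: "\<And>y. y \<in> T \<Longrightarrow> norm y \<le> C2 * dual_norm K (B y)"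
    using iso unfolding restriction_isomorphism_def Let_def res by blast
  define C where "C = 1 + \<bar>C1\<bar> + \<bar>C2\<bar>"
  have le: "C1 \<le> C" "C2 \<le> C" by (auto simp: C_def)
  have nn: "0 \<le> dual_norm K (B y)" if "y \<in> T" for y
    using dual_norm_nonneg[OF bij_betwE[OF bij, rule_format, OF that] K] by (simp add: res)
  show thesis
  proof (rule that[of C])
    show "0 < C" by (simp add: C_def add_pos_nonneg)
    fix y assume y: "y \<in> T"
    show "dual_norm K (B y) \<le> C * norm y"
      using C1[OF y] mult_right_mono[OF le(1) norm_ge_zero[of y]] by simp
    show "norm y \<le> C * dual_norm K (B y)"
      using C2[OF y] mult_right_mono[OF le(2) nn[OF y]] by simp
    fix y' assume y': "y' \<in> T" and eq: "\<And>k. k \<in> K \<Longrightarrow> B y k = B y' k"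
    have "restrict (B y) K = restrict (B y') K" using eq by (rule restrict_ext)
    then show "y = y'" using bij y y' by (auto simp: bij_betw_def dest: inj_onD)
  qed
qed

section \<open>Comparison of exponents\<close>

lemma powr_add_le:
  fixes a b \<theta> :: real
  assumes "0 \<le> a" "0 \<le> b" "0 < \<theta>"
  shows "(a + b) powr \<theta> \<le> 2 powr \<theta> * (a powr \<theta> + b powr \<theta>)"
proof -
  have "(a + b) powr \<theta> \<le> (2 * max a b) powr \<theta>" using assms by (intro powr_mono2) auto
  also have "\<dots> = 2 powr \<theta> * max a b powr \<theta>" using assms by (simp add: powr_mult)
  also have "\<dots> \<le> 2 powr \<theta> * (a powr \<theta> + b powr \<theta>)"
    by (intro mult_left_mono) (auto simp: max_def)
  finally show ?thesis .
qed

text \<open>Every exponent admissible for \<open>f'\<close> is admissible for \<open>f\<close>: up to constants,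
  \<open>\<bar>f x\<bar> powr \<theta> \<le> \<bar>f' (p x)\<bar> powr \<theta> + g x powr (2 * \<theta>) \<le> g' (p x) + g x\<close>, where the second step
  uses \<open>2 * \<theta> \<ge> 1\<close> and \<open>g x \<le> 1\<close>.\<close>

lemma lojasiewicz_exponent_le:
  assumes p: "filterlim p (inf (nhds b) (principal T)) (inf (nhds a) (principal S))"
    and C: "0 < C"
    and vals: "\<forall>\<^sub>F x in inf (nhds a) (principal S). \<bar>f x\<bar> \<le> \<bar>f' (p x)\<bar> + C * (g x)\<^sup>2"
    and gradients: "\<forall>\<^sub>F x in inf (nhds a) (principal S). g' (p x) \<le> C * g x"
    and small: "\<forall>\<^sub>F x in inf (nhds a) (principal S). g x \<le> 1"
  shows "lojasiewicz_exponent S f g a \<le> lojasiewicz_exponent T f' g' b"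
  unfolding lojasiewicz_exponent_def
proof (rule INF_superset_mono[OF _ order_refl], safe)
  fix \<theta> C0 :: real
  assume \<theta>: "1 / 2 \<le> \<theta>" "\<theta> < 1" and C0: "0 < C0"
    and ineq: "\<forall>\<^sub>F x in nhds b. x \<in> T \<longrightarrow> C0 * \<bar>f' x\<bar> powr \<theta> \<le> g' x"
  define D where "D = 2 powr \<theta> * (C / C0 + C powr \<theta>)"
  have D: "D > 0" using C C0 by (simp add: D_def add_pos_pos)
  have "\<forall>\<^sub>F y in inf (nhds b) (principal T). C0 * \<bar>f' y\<bar> powr \<theta> \<le> g' y"
    using ineq by (simp add: eventually_inf_principal)
  from eventually_compose_filterlim[OF this p] vals gradients small
  have "\<forall>\<^sub>F x in inf (nhds a) (principal S). 1 / D * \<bar>f x\<bar> powr \<theta> \<le> g x"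
  proof eventually_elim
    case (elim x)
    have "C0 * \<bar>f' (p x)\<bar> powr \<theta> \<le> C * g x" using elim by simp
    moreover from this have "0 \<le> C * g x" by (rule order_trans[rotated]) (use C0 in simp)
    ultimately have g0: "0 \<le> g x" and lead: "\<bar>f' (p x)\<bar> powr \<theta> \<le> C / C0 * g x"
      using C C0 by (auto simp: field_simps zero_le_mult_iff)
    have "(C * (g x)\<^sup>2) powr \<theta> = C powr \<theta> * (g x) powr (2 * \<theta>)"
    proof (cases "g x = 0")
      case False
      then have "(g x)\<^sup>2 = g x powr 2" using g0 by (simp add: powr_numeral)
      then have "(g x)\<^sup>2 powr \<theta> = g x powr (2 * \<theta>)" by (simp only: powr_powr)
      then show ?thesis using C by (simp add: powr_mult)
    qed simp
    also have "\<dots> \<le> C powr \<theta> * g x powr 1"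
      using g0 elim \<theta> by (intro mult_left_mono powr_mono') auto
    finally have rest: "(C * (g x)\<^sup>2) powr \<theta> \<le> C powr \<theta> * g x" using g0 by simp
    have "\<bar>f x\<bar> powr \<theta> \<le> (\<bar>f' (p x)\<bar> + C * (g x)\<^sup>2) powr \<theta>"
      using elim \<theta> by (intro powr_mono2) auto
    also have "\<dots> \<le> 2 powr \<theta> * (\<bar>f' (p x)\<bar> powr \<theta> + (C * (g x)\<^sup>2) powr \<theta>)"
      using C \<theta> by (intro powr_add_le) auto
    also have "\<dots> \<le> 2 powr \<theta> * (C / C0 * g x + C powr \<theta> * g x)"
      using lead rest by (intro mult_left_mono add_mono) auto
    finally have "\<bar>f x\<bar> powr \<theta> \<le> D * g x" by (simp add: D_def algebra_simps)
    then show ?case using D by (simp add: field_simps)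
  qed
  then show "\<exists>C>0. \<forall>\<^sub>F x in nhds a. x \<in> S \<longrightarrow> C * \<bar>f x\<bar> powr \<theta> \<le> g x"
    using D by (intro exI[of _ "1 / D"]) (simp add: eventually_inf_principal)
qed

section \<open>Errors transversal to the reduced manifold\<close>

text \<open>In the application \<open>y = M x\<close> and \<open>y' = M x'\<close> with \<open>w = x - x'\<close>. Applying \<open>R\<close> to
  \<open>y - y' \<approx> L w\<close> removes \<open>y'\<close>, and the remainder of size \<open>e * norm w\<close> is absorbed into the left
  side because \<open>m * r * e \<le> 1 / 2\<close>.\<close>

lemma transversal_error_le:
  fixes R :: "'b::real_normed_vector \<Rightarrow> 'b"
  assumes R: "linear R" "\<And>y. norm (R y) \<le> r * norm y" "0 \<le> r" "R (L w) = L w"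
    and m: "norm w \<le> m * norm (L w)" "0 \<le> m"
    and eps: "norm (y - y' - L w) \<le> e * norm w" "m * r * e \<le> 1 / 2"
    and y': "R y' = 0"
  shows "norm w \<le> 2 * m * r * norm y"
proof -
  have "L w = R y - R (y - y' - L w)" using R(1,4) y' by (simp add: linear_diff)
  then have "norm (L w) \<le> norm (R y) + norm (R (y - y' - L w))" by (metis norm_triangle_ineq4)
  also have "\<dots> \<le> r * norm y + r * (e * norm w)"
    using R(3) eps(1) by (intro add_mono order_trans[OF R(2)] mult_left_mono) auto
  finally have "m * norm (L w) \<le> m * (r * norm y + r * (e * norm w))"
    using m(2) by (rule mult_left_mono)
  also have "\<dots> = m * r * norm y + (m * r * e) * norm w" by (simp add: algebra_simps)
  also have "\<dots> \<le> m * r * norm y + 1 / 2 * norm w"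
    using eps(2) by (intro add_left_mono mult_right_mono) auto
  finally show ?thesis using m(1) by simp
qed

text \<open>The mean value inequality on the segment from \<open>x\<close> to \<open>x'\<close>: the gradient there is of order
  \<open>norm (M x)\<close> by the Lipschitz bound, and so is the length of the segment, which makes the
  energy difference quadratic in \<open>norm (M x)\<close>.\<close>

lemma energy_gap_le:
  fixes E :: "'a::real_normed_vector \<Rightarrow> real"
  assumes B: "\<And>y v. \<bar>B y v\<bar> \<le> \<kappa> * norm y * norm v" "0 \<le> \<kappa>"
    and C: "convex C" "x \<in> C" "x' \<in> C"
    and E: "\<And>p. p \<in> C \<Longrightarrow> (E has_derivative (\<lambda>v. B (M p) v)) (at p)"
    and M: "\<And>p. p \<in> C \<Longrightarrow> norm (M p - M x) \<le> Q * norm (p - x)" "0 \<le> Q"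
    and gap: "norm (x - x') \<le> P * norm (M x)" "0 \<le> P"
  shows "\<bar>E x - E x'\<bar> \<le> \<kappa> * (1 + Q * P) * P * (norm (M x))\<^sup>2"
proof -
  let ?S = "closed_segment x x'"
  let ?b = "\<kappa> * ((1 + Q * P) * norm (M x))"
  have SC: "?S \<subseteq> C" using C by (simp add: closed_segment_subset)
  have bd: "onorm (\<lambda>v. B (M p) v) \<le> ?b" if p: "p \<in> ?S" for p
  proof (rule onorm_bound)
    show "0 \<le> ?b" using B(2) M(2) gap(2) by simp
    have "norm (p - x) \<le> norm (x - x')"
      using segment_bound(1)[OF p] by (simp add: norm_minus_commute)
    then have "Q * norm (p - x) \<le> Q * (P * norm (M x))"
      using gap M(2) by (intro mult_left_mono) auto
    with M(1)[of p] p SC have "norm (M p - M x) \<le> Q * (P * norm (M x))" by force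
    then have Mp: "norm (M p) \<le> (1 + Q * P) * norm (M x)"
      using norm_triangle_sub[of "M p" "M x"] by (simp add: algebra_simps)
    fix v :: 'a
    have "\<kappa> * norm (M p) * norm v \<le> \<kappa> * ((1 + Q * P) * norm (M x)) * norm v"
      using B(2) Mp by (intro mult_right_mono mult_left_mono) auto
    then show "norm (B (M p) v) \<le> ?b * norm v" using B(1)[of "M p" v] by simp
  qed
  have "norm (E x - E x') \<le> ?b * norm (x - x')"
    by (rule differentiable_bound[where S="?S" and f'="\<lambda>p v. B (M p) v"])
      (use E SC bd in \<open>auto intro: has_derivative_at_withinI\<close>)
  also have "\<dots> \<le> ?b * (P * norm (M x))"
    using gap B(2) M(2) by (intro mult_left_mono) auto
  finally show ?thesis by (simp add: power2_eq_square mult_ac)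
qed

section \<open>Equality of the exponents\<close>

theorem theorem2p4:
  fixes B :: "'y::banach \<Rightarrow> 'x::banach \<Rightarrow> real"
    and U V W K Z :: "'x set"
    and YK :: "'y set"
    and E \<Gamma> :: "'x \<Rightarrow> real"
    and M L :: "'x \<Rightarrow> 'y"
    and R :: "'y \<Rightarrow> 'y"
    and \<psi> c :: "'x \<Rightarrow> 'x"
  assumes pairing: "bounded_bilinear B"
    and U: "open U" "0 \<in> U"
    and E: "real_analytic_on UNIV U E" "E 0 = 0" "(E has_derivative (\<lambda>_. 0)) (at 0)"
    and M: "real_analytic_on UNIV U M"
    and gradient: "\<And>x. x \<in> U \<Longrightarrow> (E has_derivative (\<lambda>v. B (M x) v)) (at x)"
    and L: "(M has_derivative L) (at 0)" "fredholm L"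
    and K: "K = {x. L x = 0}"
    and Z: "closed Z" "direct_sum K Z"
    and YK: "YK = annihilator B Z" "topological_direct_sum (range L) YK"
    and rho: "restriction_isomorphism B YK K"
    and R: "R = proj_along (range L) YK"
    and V: "openin (top_of_set K) V" "0 \<in> V"
    and W: "openin (top_of_set Z) W" "0 \<in> W"
    and psi: "real_analytic_on K V \<psi>" "\<psi> \<in> V \<rightarrow> W" "\<psi> 0 = 0"
    and c: "\<And>\<xi>. c \<xi> = \<xi> + \<psi> \<xi>"
    and reduced: "\<And>\<xi>. \<xi> \<in> V \<Longrightarrow> c \<xi> \<in> U" "\<And>\<xi>. \<xi> \<in> V \<Longrightarrow> R (M (c \<xi>)) = 0"
    and Gamma: "\<And>\<xi>. \<Gamma> \<xi> = E (c \<xi>)"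
  shows "theta_LS M E 0 = theta_R K \<Gamma> 0"
proof -
  interpret B: bounded_bilinear B by (rule pairing)
  interpret L: bounded_linear L using L(2) by (simp add: fredholm_def)
  have subK: "subspace K" and subZ: "subspace Z" and KZ: "K \<inter> Z = {0}"
    using Z(2) by (auto simp: direct_sum_def)
  have K0: "0 \<in> K" using subK by (rule subspace_0)
  have VK: "V \<subseteq> K" using V(1) by (rule openin_imp_subset)
  have psiZ: "\<psi> \<xi> \<in> Z" if "\<xi> \<in> V" for \<xi>
    using psi(2) openin_imp_subset[OF W(1)] that by blast

  let ?p = "proj_along K Z"
  have p: "?p x \<in> K" "x - ?p x \<in> Z" for x
    using direct_sum_decomposition[OF Z(2)] by blast+
  have Lp: "L (x - ?p x) = L x" for x using p(1)[of x] by (simp add: K L.diff)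
  have rangeL: "L ` Z = range L"
  proof
    show "range L \<subseteq> L ` Z" using p(2) Lp by (metis image_eqI image_subsetI)
  qed blast
  have injL: "inj_on L Z"
  proof (rule inj_onI)
    fix z z' assume "z \<in> Z" "z' \<in> Z" "L z = L z'"
    then have "z - z' \<in> K \<inter> Z" using subZ by (simp add: K L.diff subspace_diff)
    then show "z = z'" using KZ by simp
  qed
  have "closed (L ` Z)" using L(2) by (simp add: rangeL fredholm_def)
  with L.bounded_linear_axioms subZ Z(1) obtain m
    where m: "0 < m" "\<And>z. z \<in> Z \<Longrightarrow> norm z \<le> m * norm (L z)"
    using injL by (rule bounded_inverse_on_closed_subspace) blast

  have ds: "direct_sum (range L) YK" and blR: "bounded_linear R"
    using YK(2) by (auto simp: topological_direct_sum_def R)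
  have RL: "R (L x) = L x" for x
    using ds by (simp add: R proj_along_eq direct_sum_def subspace_0)
  have R0: "y \<in> YK" if "R y = 0" for y
    using direct_sum_decomposition(2)[OF ds, of y] that by (simp add: R)
  obtain r where r: "0 < r" "\<And>y. norm (R y) \<le> r * norm y"
    using bounded_linear.pos_bounded[OF blR] by (auto simp: mult.commute)

  have McYK: "M (c \<xi>) \<in> YK" if "\<xi> \<in> V" for \<xi> using reduced(2) that by (intro R0) auto
  have BZ: "B y z = 0" if "y \<in> YK" "z \<in> Z" for y z
    using that by (simp add: YK(1) annihilator_def)
  obtain C1 where C1: "0 < C1" "\<And>y. y \<in> YK \<Longrightarrow> dual_norm K (B y) \<le> C1 * norm y"
     "\<And>y. y \<in> YK \<Longrightarrow> norm y \<le> C1 * dual_norm K (B y)"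
    and injB: "\<And>y y'. \<lbrakk>y \<in> YK; y' \<in> YK; \<And>k. k \<in> K \<Longrightarrow> B y k = B y' k\<rbrakk> \<Longrightarrow> y = y'"
    by (rule restriction_isomorphismD[OF rho K0]) blast

  have c0: "c 0 = 0" by (simp add: c psi)
  have M0: "M 0 = 0"
  proof (rule injB)
    show "M 0 \<in> YK" using McYK[OF V(2)] by (simp add: c0)
    show "0 \<in> YK" by (simp add: YK(1) annihilator_def B.zero_left)
    have "(\<lambda>v. B (M 0) v) = (\<lambda>_. 0)"
      using gradient[OF U(2)] E(3) by (rule has_derivative_unique)
    then show "B (M 0) k = B 0 k" for k by (simp add: fun_eq_iff B.zero_left)
  qed
  have M_lim: "(M \<longlongrightarrow> 0) (nhds 0)"
    using has_derivative_continuous[OF L(1)] tendsto_at_iff_tendsto_nhds[of M 0]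
    by (simp add: isCont_def M0)

  have calm: "\<exists>P\<ge>0. \<forall>\<^sub>F y in at \<xi> within K. norm (c y - c \<xi>) \<le> P * norm (y - \<xi>)"
    if \<xi>: "\<xi> \<in> V" for \<xi>
  proof -
    obtain P where P: "0 \<le> P" "\<forall>\<^sub>F y in at \<xi> within K. norm (\<psi> y - \<psi> \<xi>) \<le> P * norm (y - \<xi>)"
      by (rule real_analytic_on_calm[OF subK psi(1) \<xi>])
    have "norm (c y - c \<xi>) \<le> (1 + P) * norm (y - \<xi>)"
      if "norm (\<psi> y - \<psi> \<xi>) \<le> P * norm (y - \<xi>)" for y
    proof -
      have "c y - c \<xi> = (y - \<xi>) + (\<psi> y - \<psi> \<xi>)" by (simp add: c)
      then have "norm (c y - c \<xi>) \<le> norm (y - \<xi>) + norm (\<psi> y - \<psi> \<xi>)"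
        by (simp only: norm_triangle_ineq)
      then show ?thesis using that by (simp add: distrib_right)
    qed
    with P show ?thesis by (intro exI[of _ "1 + P"]) (auto elim: eventually_mono)
  qed
  have near_V: "\<forall>\<^sub>F y in nhds \<xi>. y \<in> K \<longrightarrow> y \<in> V" if "\<xi> \<in> V" for \<xi>
  proof -
    obtain G where "open G" "V = K \<inter> G" using V(1) by (auto simp: openin_open)
    then show ?thesis using that by (auto simp: eventually_nhds intro!: exI[of _ G])
  qed

  have grad_Gamma: "dual_norm K (frechet_derivative \<Gamma> (at \<xi> within K)) = dual_norm K (B (M (c \<xi>)))"
    if \<xi>: "\<xi> \<in> V" for \<xi>
  proof (rule dual_norm_frechet_derivative)
    show "subspace K" by (rule subK)
    show "\<xi> \<in> K" using \<xi> VK by blast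
    have \<Gamma>: "\<Gamma> = (\<lambda>\<xi>. E (c \<xi>))" using Gamma by blast
    obtain P where P: "\<forall>\<^sub>F y in at \<xi> within K. norm (c y - c \<xi>) \<le> P * norm (y - \<xi>)"
      using calm[OF \<xi>] by blast
    show "(\<Gamma> has_derivative B (M (c \<xi>))) (at \<xi> within K)"
      unfolding \<Gamma>
    proof (rule has_derivative_compose_calm[OF gradient P B.bounded_linear_right])
      show "c \<xi> \<in> U" using reduced(1) \<xi> .
      \<comment> \<open>the increment of \<open>\<psi>\<close> lies in \<open>Z\<close>, which \<open>M (c \<xi>) \<in> Y\<^sub>K\<close> annihilates\<close>
      have "B (M (c \<xi>)) (c y - c \<xi>) = B (M (c \<xi>)) (y - \<xi>)" if "y \<in> V" for y
      proof -
        have "\<psi> y - \<psi> \<xi> \<in> Z" using subZ psiZ that \<xi> by (simp add: subspace_diff)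
        then have "B (M (c \<xi>)) (\<psi> y - \<psi> \<xi>) = 0" using McYK[OF \<xi>] BZ by blast
        moreover have "c y - c \<xi> = (y - \<xi>) + (\<psi> y - \<psi> \<xi>)" by (simp add: c)
        ultimately show ?thesis by (simp only: B.add_right)
      qed
      moreover have "\<forall>\<^sub>F y in at \<xi> within K. y \<in> V"
        using near_V[OF \<xi>] by (auto simp: eventually_at_filter elim: eventually_mono)
      ultimately show "\<forall>\<^sub>F y in at \<xi> within K. B (M (c \<xi>)) (c y - c \<xi>) = B (M (c \<xi>)) (y - \<xi>)"
        by (auto elim: eventually_mono)
    qed
  qed

  let ?FK = "inf (nhds 0) (principal K)"
  have FK_V: "\<forall>\<^sub>F \<xi> in ?FK. \<xi> \<in> V" using near_V[OF V(2)] by (simp add: eventually_inf_principal)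
  have c_lim: "(c \<longlongrightarrow> 0) ?FK"
  proof -
    obtain P where P: "\<forall>\<^sub>F y in at 0 within K. norm (c y - c 0) \<le> P * norm (y - 0)"
      using calm[OF V(2)] by blast
    have "\<forall>\<^sub>F y in ?FK. norm (c y) \<le> P * norm y"
      using P unfolding eventually_at_filter eventually_inf_principal
      by (rule eventually_mono) (auto simp: c0)
    moreover have "((\<lambda>y. P * norm y) \<longlongrightarrow> 0) ?FK"
    proof (rule tendsto_mono)
      show "((\<lambda>y. P * norm y) \<longlongrightarrow> 0) (nhds 0)"
        by (auto intro!: tendsto_eq_intros filterlim_ident)
    qed simp
    ultimately show ?thesis by (rule Lim_null_comparison)
  qed
  have Mc_lim: "((\<lambda>\<xi>. M (c \<xi>)) \<longlongrightarrow> 0) ?FK"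
    using M_lim c_lim by (rule filterlim_compose)

  let ?g = "\<lambda>\<xi>. dual_norm K (frechet_derivative \<Gamma> (at \<xi> within K))"
  have g_le: "?g \<xi> \<le> C1 * norm (M (c \<xi>))" and le_g: "norm (M (c \<xi>)) \<le> C1 * ?g \<xi>"
    if "\<xi> \<in> V" for \<xi>
    using C1 McYK that by (auto simp: grad_Gamma)

  show ?thesis
    unfolding theta_LS_def theta_R_def
  proof (rule antisym)
    show "lojasiewicz_exponent K \<Gamma> ?g 0 \<le> lojasiewicz_exponent UNIV E (\<lambda>x. norm (M x)) 0"
    proof (rule lojasiewicz_exponent_le[where p = c and C = C1])
      show "filterlim c (inf (nhds 0) (principal UNIV)) ?FK"
        using c_lim by (simp flip: top_eq_principal_UNIV)
      show "\<forall>\<^sub>F \<xi> in ?FK. \<bar>\<Gamma> \<xi>\<bar> \<le> \<bar>E (c \<xi>)\<bar> + C1 * (?g \<xi>)\<^sup>2"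
        using C1(1) by (simp add: Gamma)
      show "\<forall>\<^sub>F \<xi> in ?FK. norm (M (c \<xi>)) \<le> C1 * ?g \<xi>"
        using FK_V by (rule eventually_mono) (rule le_g)
      have "((\<lambda>\<xi>. C1 * norm (M (c \<xi>))) \<longlongrightarrow> C1 * norm (0::'y)) ?FK"
        by (intro tendsto_intros Mc_lim)
      then have "\<forall>\<^sub>F \<xi> in ?FK. C1 * norm (M (c \<xi>)) < 1" by (rule order_tendstoD) simp
      with FK_V show "\<forall>\<^sub>F \<xi> in ?FK. ?g \<xi> \<le> 1"
        by eventually_elim (use g_le in force)
    qed (rule C1(1))
  next
    obtain \<kappa> where \<kappa>: "0 < \<kappa>" "\<And>y v. \<bar>B y v\<bar> \<le> \<kappa> * norm y * norm v"
      using B.pos_bounded by (auto simp: mult_ac)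
    obtain l where l: "0 < l" "\<And>x. norm (L x) \<le> l * norm x"
      using L.pos_bounded by (auto simp: mult.commute)
    obtain D rM where D: "0 \<le> D" and rM: "0 < rM"
      and strict: "\<And>\<rho> x y. \<lbrakk>norm (x - 0) \<le> \<rho>; norm (y - 0) \<le> \<rho>; \<rho> \<le> rM\<rbrakk>
        \<Longrightarrow> norm (M x - M y - L (x - y)) \<le> D * \<rho> * norm (x - y)"
      by (rule real_analytic_on_strict_derivative[OF M U(2) L(1)]) blast
    obtain rU where rU: "0 < rU" "cball 0 rU \<subseteq> U" using U open_contains_cball by blast
    \<comment> \<open>on the ball of radius \<open>\<delta>\<close> the Lipschitz constant \<open>D * \<delta>\<close> of \<open>M - L\<close> is at most
      \<open>1 / (2 * m * r)\<close>, as absorbing the remainder requires; the \<open>+ 1\<close> avoids division by zero\<close>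
    define \<delta> where "\<delta> = min (min rM rU) (1 / (2 * (m * r * D + 1)))"
    have mrD: "0 \<le> m * r * D" using m r D by simp
    then have \<delta>: "0 < \<delta>" "\<delta> \<le> rM" "\<delta> \<le> rU" "\<delta> \<le> 1 / (2 * (m * r * D + 1))"
      using rM rU by (auto simp: \<delta>_def)
    have "(m * r * D + 1) * \<delta> \<le> 1 / 2" using \<delta>(4) mrD by (simp add: field_simps)
    then have \<delta>_small: "m * r * (D * \<delta>) \<le> 1 / 2" using \<delta>(1) by (simp add: algebra_simps)
    have strict\<delta>: "norm (M x - M y - L (x - y)) \<le> (D * \<delta>) * norm (x - y)"
      if "norm x \<le> \<delta>" "norm y \<le> \<delta>" for x y
      using strict[of x \<delta> y] that \<delta>(2) by simp
    define Q where "Q = l + D * \<delta>"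
    have Q: "0 \<le> Q" using l D \<delta> by (simp add: Q_def)
    have lip: "norm (M x - M y) \<le> Q * norm (x - y)" if "norm x \<le> \<delta>" "norm y \<le> \<delta>" for x y
      using strict\<delta>[OF that] l(2)[of "x - y"] norm_triangle_sub[of "M x - M y" "L (x - y)"]
      by (simp add: Q_def distrib_right)
    define P where "P = 2 * m * r"
    have P: "0 \<le> P" using m r by (simp add: P_def)

    have p_lim: "filterlim ?p ?FK (nhds 0)"
    proof -
      \<comment> \<open>the projection along \<open>Z\<close> is continuous at \<open>0\<close> because \<open>L\<close> sees only the \<open>Z\<close>-part of \<open>x\<close>
        and controls it\<close>
      have "norm (x - ?p x) \<le> m * norm (L x)" for x using m(2)[OF p(2)[of x]] by (simp add: Lp)
      moreover have "((\<lambda>x. m * norm (L x)) \<longlongrightarrow> m * norm (L 0)) (nhds 0)"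
        by (intro tendsto_intros L.tendsto filterlim_ident)
      ultimately have "((\<lambda>x. x - ?p x) \<longlongrightarrow> 0) (nhds 0)"
        using Lim_null_comparison[of "\<lambda>x. x - ?p x" "\<lambda>x. m * norm (L x)"] by (simp add: L.zero)
      from tendsto_diff[OF filterlim_ident this] have "(?p \<longlongrightarrow> 0) (nhds 0)" by simp
      then show ?thesis using p(1) by (simp add: filterlim_inf filterlim_principal)
    qed
    have ev: "\<forall>\<^sub>F x in nhds 0. ?p x \<in> V \<and> norm x \<le> \<delta> \<and> norm (c (?p x)) \<le> \<delta>"
    proof (intro eventually_conj)
      have small: "\<forall>\<^sub>F x in F. norm (h x) \<le> \<delta>" if "(h \<longlongrightarrow> 0) F" for h :: "'x \<Rightarrow> 'x" and F
        using tendstoD[OF that \<delta>(1)] by (auto elim: eventually_mono)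
      show "\<forall>\<^sub>F x in nhds 0. ?p x \<in> V" using FK_V p_lim by (rule eventually_compose_filterlim)
      show "\<forall>\<^sub>F x in nhds 0. norm x \<le> \<delta>"
        using \<delta>(1) by (auto simp: eventually_nhds_metric dist_norm intro: exI[of _ \<delta>])
      show "\<forall>\<^sub>F x in nhds 0. norm (c (?p x)) \<le> \<delta>"
        by (rule small[OF filterlim_compose[OF c_lim p_lim]])
    qed
    have key: "norm (M (c (?p x))) \<le> (1 + Q * P) * norm (M x)"
        "\<bar>E x - E (c (?p x))\<bar> \<le> \<kappa> * (1 + Q * P) * P * (norm (M x))\<^sup>2"
      if x: "?p x \<in> V \<and> norm x \<le> \<delta> \<and> norm (c (?p x)) \<le> \<delta>" for x
    proof -
      let ?x' = "c (?p x)"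
      have "(x - ?p x) - \<psi> (?p x) \<in> Z" using subZ p(2) psiZ x by (blast intro: subspace_diff)
      then have wZ: "x - ?x' \<in> Z" by (simp add: c diff_diff_eq)
      have gap: "norm (x - ?x') \<le> P * norm (M x)"
        unfolding P_def
      proof (rule transversal_error_le)
        show "linear R" using blR by (rule bounded_linear.linear)
        show "R (L (x - ?x')) = L (x - ?x')" by (rule RL)
        show "norm (x - ?x') \<le> m * norm (L (x - ?x'))" using m(2) wZ .
        show "norm (M x - M ?x' - L (x - ?x')) \<le> (D * \<delta>) * norm (x - ?x')"
          using strict\<delta> x by blast
        show "R (M ?x') = 0" using reduced(2) x by blast
      qed (use r m \<delta>_small in auto)
      have "norm (M ?x' - M x) \<le> Q * norm (?x' - x)" using lip x by blast
      also have "\<dots> \<le> Q * (P * norm (M x))"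
        using gap Q by (intro mult_left_mono) (simp_all add: norm_minus_commute)
      finally show "norm (M ?x') \<le> (1 + Q * P) * norm (M x)"
        using norm_triangle_sub[of "M ?x'" "M x"] by (simp add: algebra_simps)
      show "\<bar>E x - E ?x'\<bar> \<le> \<kappa> * (1 + Q * P) * P * (norm (M x))\<^sup>2"
      proof (rule energy_gap_le[where B = B and C = "cball 0 \<delta>"])
        show "(E has_derivative (\<lambda>v. B (M q) v)) (at q)" if "q \<in> cball 0 \<delta>" for q
          using that rU \<delta>(3) by (intro gradient) auto
        show "norm (M q - M x) \<le> Q * norm (q - x)" if "q \<in> cball 0 \<delta>" for q
          using that x by (intro lip) auto
      qed (use \<kappa> x Q P gap in auto)
    qed

    define C where "C = C1 * (1 + Q * P) + \<kappa> * (1 + Q * P) * P"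
    have QP: "0 < 1 + Q * P" using Q P by (simp add: add_pos_nonneg)
    have C: "0 < C" "C1 * (1 + Q * P) \<le> C" "\<kappa> * (1 + Q * P) * P \<le> C"
      using QP C1(1) \<kappa>(1) P by (auto simp: C_def add_pos_nonneg)
    have UNIV_filter: "inf (nhds 0) (principal UNIV) = nhds (0::'x)"
      by (simp flip: top_eq_principal_UNIV)
    show "lojasiewicz_exponent UNIV E (\<lambda>x. norm (M x)) 0 \<le> lojasiewicz_exponent K \<Gamma> ?g 0"
    proof (rule lojasiewicz_exponent_le[where p = ?p and C = C], unfold UNIV_filter)
      show "filterlim ?p ?FK (nhds 0)" by (rule p_lim)
      show "0 < C" by (rule C(1))
      show "\<forall>\<^sub>F x in nhds 0. \<bar>E x\<bar> \<le> \<bar>\<Gamma> (?p x)\<bar> + C * (norm (M x))\<^sup>2"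
        using ev
      proof (rule eventually_mono)
        fix x assume x: "?p x \<in> V \<and> norm x \<le> \<delta> \<and> norm (c (?p x)) \<le> \<delta>"
        have "\<kappa> * (1 + Q * P) * P * (norm (M x))\<^sup>2 \<le> C * (norm (M x))\<^sup>2"
          using C(3) by (rule mult_right_mono) simp
        then show "\<bar>E x\<bar> \<le> \<bar>\<Gamma> (?p x)\<bar> + C * (norm (M x))\<^sup>2"
          using key(2)[OF x] unfolding Gamma by linarith
      qed
      show "\<forall>\<^sub>F x in nhds 0. ?g (?p x) \<le> C * norm (M x)"
        using ev
      proof (rule eventually_mono)
        fix x assume x: "?p x \<in> V \<and> norm x \<le> \<delta> \<and> norm (c (?p x)) \<le> \<delta>"
        have "?g (?p x) \<le> C1 * norm (M (c (?p x)))" using g_le x by blast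
        also have "\<dots> \<le> C1 * ((1 + Q * P) * norm (M x))"
          using key(1)[OF x] C1(1) by (intro mult_left_mono) auto
        also have "\<dots> \<le> C * norm (M x)"
          using mult_right_mono[OF C(2) norm_ge_zero[of "M x"]] by (simp add: mult.assoc)
        finally show "?g (?p x) \<le> C * norm (M x)" .
      qed
      show "\<forall>\<^sub>F x in nhds 0. norm (M x) \<le> 1"
        using tendstoD[OF M_lim zero_less_one] by (auto elim: eventually_mono)
    qed
  qed
qed

end
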